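(* In the setting described in the context, the pair $B,B^*$ is a tridiagonal pair on $V$. The sequence $bq^{2i-d}$ ($0\le i\le d$) is a standard ordering of the eigenvalues of $B$ and the sequence $b^*q^{d-2i}$ ($0\le i\le d$) is a standard ordering of the eigenvalues of $B^*$.
   Context: $\mathbb K$ is an algebraically closed field, $q\in\mathbb K$ nonzero and not a root of unity, $V$ a nonzero finite-dimensional $\mathbb K$-vector space. A tridiagonal pair on $V$ is an ordered pair $A,A^*$ of linear maps $V\to V$ such that: (i) each of $A,A^*$ is diagonalizable; (ii) there is an ordering $V_0,\dots,V_d$ of the eigenspaces of $A$ with $A^*V_i\subseteq V_{i-1}+V_i+V_{i+1}$ ($V_{-1}=V_{d+1}=0$); (iii) there is an ordering $V^*_0,\dots,V^*_\delta$ of the eigenspaces of $A^*$ with $AV^*_i\subseteq V^*_{i-1}+V^*_i+V^*_{i+1}$ ($V^*_{-1}=V^*_{\delta+1}=0$); (iv) no subspace $W\ne0,V$ satisfies $AW\subseteq W$, $A^*W\subseteq W$. It is known $d=\delta$; orderings of eigenspaces as in (ii),(iii) are called standard, and an ordering of eigenvalues is standard if the corresponding eigenspace ordering is. Setting: $A,A^*$ is a tridiagonal pair on $V$; $V_0,\dots,V_d$ (resp. $V^*_0,\dots,V^*_d$) is a standard ordering of the eigenspaces of $A$ (resp. $A^*$); the eigenvalue of $A$ on $V_i$ is $aq^{2i-d}$ and that of $A^*$ on $V^*_i$ is $a^*q^{d-2i}$ for some nonzero $a,a^*\in\mathbb K$; $b,b^*\in\mathbb K$ are nonzero. For $0\le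 i\le d$ the subspaces $(V^*_0+\cdots+V^*_i)\cap(V_0+\cdots+V_{d-i})$ form a decomposition of $V$ (nonzero, direct sum equal to $V$), as do the subspaces $(V^*_{d-i}+\cdots+V^*_d)\cap(V_i+\cdots+V_d)$. $B:V\to V$ is the linear map acting as $bq^{2i-d}I$ on $(V^*_0+\cdots+V^*_i)\cap(V_0+\cdots+V_{d-i})$ for each $i$, and $B^*:V\to V$ is the linear map acting as $b^*q^{d-2i}I$ on $(V^*_{d-i}+\cdots+V^*_d)\cap(V_i+\cdots+V_d)$ for each $i$. *)

theory Defs
  imports Main "HOL-Computational_Algebra.Polynomial"
begin

text \<open>Vector spaces are represented by a scalar multiplication s :: 'k \<Rightarrow> 'v \<Rightarrow> 'v
  satisfying the HOL locale vector_space; V is the whole carrier type 'v.\<close>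

definition alg_closed_field :: "'k::field itself \<Rightarrow> bool" where
  "alg_closed_field _ \<longleftrightarrow> (\<forall>p::'k poly. degree p > 0 \<longrightarrow> (\<exists>x. poly p x = 0))"

definition eigenspace :: "('k::field \<Rightarrow> 'v::ab_group_add \<Rightarrow> 'v) \<Rightarrow> ('v \<Rightarrow> 'v) \<Rightarrow> 'k \<Rightarrow> 'v set" where
  "eigenspace s A \<theta> = {v. A v = s \<theta> v}"

definition is_eigenvalue :: "('k::field \<Rightarrow> 'v::ab_group_add \<Rightarrow> 'v) \<Rightarrow> ('v \<Rightarrow> 'v) \<Rightarrow> 'k \<Rightarrow> bool" where
  "is_eigenvalue s A \<theta> \<longleftrightarrow> eigenspace s A \<theta> \<noteq> {0}"

definition ssum :: "('k::field \<Rightarrow> 'v::ab_group_add \<Rightarrow> 'v) \<Rightarrow> (nat \<Rightarrow> 'v set) \<Rightarrow> nat set \<Rightarrow> 'v set" where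
  "ssum s W I = module.span s (\<Union>j\<in>I. W j)"

definition diagonalizable :: "('k::field \<Rightarrow> 'v::ab_group_add \<Rightarrow> 'v) \<Rightarrow> ('v \<Rightarrow> 'v) \<Rightarrow> bool" where
  "diagonalizable s A \<longleftrightarrow> module.span s (\<Union>\<theta>. eigenspace s A \<theta>) = UNIV"

definition standard_eigenvalue_ordering ::
  "('k::field \<Rightarrow> 'v::ab_group_add \<Rightarrow> 'v) \<Rightarrow> ('v \<Rightarrow> 'v) \<Rightarrow> ('v \<Rightarrow> 'v) \<Rightarrow> nat \<Rightarrow> (nat \<Rightarrow> 'k) \<Rightarrow> bool" where
  "standard_eigenvalue_ordering s A Astar d \<theta> \<longleftrightarrow>
     inj_on \<theta> {..d} \<and>
     (\<forall>i\<le>d. is_eigenvalue s A (\<theta> i)) \<and>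
     (\<forall>\<mu>. is_eigenvalue s A \<mu> \<longrightarrow> \<mu> \<in> \<theta> ` {..d}) \<and>
     (\<forall>i\<le>d. Astar ` eigenspace s A (\<theta> i)
              \<subseteq> ssum s (\<lambda>j. eigenspace s A (\<theta> j)) {j. j \<le> d \<and> i \<le> j + 1 \<and> j \<le> i + 1})"

definition tridiagonal_pair :: "('k::field \<Rightarrow> 'v::ab_group_add \<Rightarrow> 'v) \<Rightarrow> ('v \<Rightarrow> 'v) \<Rightarrow> ('v \<Rightarrow> 'v) \<Rightarrow> bool" where
  "tridiagonal_pair s A Astar \<longleftrightarrow>
     Vector_Spaces.linear s s A \<and> Vector_Spaces.linear s s Astar \<and>
     diagonalizable s A \<and> diagonalizable s Astar \<and>
     (\<exists>d \<theta>. standard_eigenvalue_ordering s A Astar d \<theta>) \<and>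
     (\<exists>\<delta> \<theta>s. standard_eigenvalue_ordering s Astar A \<delta> \<theta>s) \<and>
     (\<forall>W. module.subspace s W \<and> A ` W \<subseteq> W \<and> Astar ` W \<subseteq> W \<longrightarrow> W = {0} \<or> W = UNIV)"

end

theory Submission
  imports Defs
begin

text \<open>Write \<open>V\<^sub>\<le>\<^sub>i\<close>, \<open>V\<^sub>\<ge>\<^sub>i\<close> for the partial sums of the eigenspaces of \<open>A\<close>, and similarly for
  \<open>A\<^sup>*\<close>. Irreducibility of \<open>A, A\<^sup>*\<close> gives the split decompositions, and on their components one reads off
  \<open>q A B - q\<^sup>-\<^sup>1 B A \<in> K I\<close> and \<open>q B A\<^sup>* - q\<^sup>-\<^sup>1 A\<^sup>* B \<in> K I\<close>, and their analogues for \<open>B\<^sup>*\<close>. Hence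
  \<open>B\<close> moves each \<open>V\<^sub>\<ge>\<^sub>i\<close> and \<open>V\<^sup>*\<^sub>\<ge>\<^sub>i\<close> by at most one step, and \<open>B\<^sup>*\<close> does the same to the opposite
  flags. The flags of \<open>B\<close> are those of \<open>V\<^sup>*\<^sub>\<le>\<close> and \<open>V\<^sub>\<le>\<close>, the flags of \<open>B\<^sup>*\<close> those of \<open>V\<^sup>*\<^sub>\<ge>\<close> and \<open>V\<^sub>\<ge>\<close>,
  which gives the two tridiagonality conditions.

  For irreducibility let \<open>W\<close> be a minimal nonzero \<open>B, B\<^sup>*\<close>-invariant subspace, let \<open>m\<close> be the
  largest index of an eigenspace of \<open>B\<close> meeting \<open>W\<close> and \<open>r'\<close> the smallest one for \<open>B\<^sup>*\<close>. By
  minimality \<open>W\<close> is the sum of the subspaces \<open>W \<inter> V\<^sub>\<le>\<^sub>i \<inter> V\<^sub>\<ge>\<^sub>j\<close> with \<open>i - j = d - m - r'\<close>, whence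
  \<open>m + r' \<le> d\<close>; the flags of \<open>A\<^sup>*\<close> give \<open>m + r' \<ge> d\<close> in the same way. So \<open>W\<close> is a sum of
  subspaces of eigenspaces of \<open>A\<close>, and likewise of \<open>A\<^sup>*\<close>, and therefore \<open>W = V\<close>.\<close>

text \<open>A separate locale, since constants declared in \<^locale>\<open>vector_space\<close> itself would be shadowed
  by their instances in its unqualified interpretation for real vector spaces.\<close>

locale vector_space_over = vector_space scale
  for scale :: "'a::field \<Rightarrow> 'b::ab_group_add \<Rightarrow> 'b" (infixr "*s" 75)
begin

section \<open>Linear maps and eigenspaces\<close>

abbreviation lin :: "('b \<Rightarrow> 'b) \<Rightarrow> bool" where
  "lin \<equiv> Vector_Spaces.linear scale scale"

abbreviation eig :: "('b \<Rightarrow> 'b) \<Rightarrow> 'a \<Rightarrow> 'b set" where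
  "eig \<equiv> eigenspace scale"

lemma lin_iff: "lin X \<longleftrightarrow> (\<forall>x y. X (x + y) = X x + X y) \<and> (\<forall>c x. X (c *s x) = c *s X x)"
  by (simp add: Vector_Spaces.linear_iff vector_space_axioms)

lemma lin_simps:
  assumes "lin X"
  shows "X (x + y) = X x + X y" "X (c *s x) = c *s X x" "X 0 = 0" "X (x - y) = X x - X y"
    "X (- x) = - X x"
proof -
  interpret Vector_Spaces.linear scale scale X
    using assms by simp
  show "X (x + y) = X x + X y" "X (c *s x) = c *s X x" "X 0 = 0" "X (x - y) = X x - X y"
    "X (- x) = - X x"
    by (simp_all add: add scale zero diff neg)
qed

lemma lin_compose: "lin X \<Longrightarrow> lin Y \<Longrightarrow> lin (\<lambda>v. X (Y v))"
  by (simp add: lin_iff)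

lemma lin_ident: "lin (\<lambda>v. v)"
  by (simp add: lin_iff)

lemma lin_scale: "lin X \<Longrightarrow> lin (\<lambda>v. c *s X v)"
  by (simp add: lin_iff scale_right_distrib mult.commute)

lemma subspace_eig: "lin X \<Longrightarrow> subspace (eig X \<mu>)"
  by (auto simp: eigenspace_def subspace_def lin_simps scale_right_distrib mult.commute)

lemma subspace_vimage: "lin X \<Longrightarrow> subspace W \<Longrightarrow> subspace {v. X v \<in> W}"
  by (auto simp: subspace_def lin_simps)

lemma span_mapsto:
  assumes "lin X" "subspace W" "\<And>v. v \<in> S \<Longrightarrow> X v \<in> W" "v \<in> span S"
  shows "X v \<in> W"
  using span_minimal[OF _ subspace_vimage[OF assms(1,2)], of S] assms(3,4) by blast

section \<open>Diagonalizable maps with listed eigenvalues, and their spectral projections\<close>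

text \<open>Zero eigenspaces are allowed, so that the notion applies to \<open>B\<close> before its
  listed scalars are known to be eigenvalues.\<close>

definition graded :: "('b \<Rightarrow> 'b) \<Rightarrow> (nat \<Rightarrow> 'a) \<Rightarrow> nat \<Rightarrow> bool" where
  "graded X \<theta> d \<longleftrightarrow> lin X \<and> inj_on \<theta> {..d} \<and> span (\<Union>i\<in>{..d}. eig X (\<theta> i)) = UNIV"

lemma graded_lin: "graded X \<theta> d \<Longrightarrow> lin X"
  by (simp add: graded_def)

lemma graded_induct:
  assumes "graded X \<theta> d" "subspace {v. P v}" "\<And>k v. k \<le> d \<Longrightarrow> X v = \<theta> k *s v \<Longrightarrow> P v"
  shows "P v"
proof -
  have "span (\<Union>i\<in>{..d}. eig X (\<theta> i)) \<subseteq> {v. P v}"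
    using assms by (intro span_minimal) (auto simp: eigenspace_def)
  then show ?thesis using assms(1) by (auto simp: graded_def)
qed

text \<open>The Lagrange interpolation polynomial of the eigenvalue with index \<open>i\<close>, evaluated at
  \<open>X\<close>: the projection onto an eigenspace along the others. Being a polynomial in \<open>X\<close>, it preserves
  every \<open>X\<close>-invariant subspace.\<close>

definition eigproj :: "('b \<Rightarrow> 'b) \<Rightarrow> (nat \<Rightarrow> 'a) \<Rightarrow> nat \<Rightarrow> nat \<Rightarrow> 'b \<Rightarrow> 'b" where
  "eigproj X \<theta> d i v =
     foldr (\<lambda>j v. inverse (\<theta> i - \<theta> j) *s (X v - \<theta> j *s v)) (filter (\<lambda>j. j \<noteq> i) [0..<Suc d]) v"

lemma eigproj_lin:
  assumes "lin X"
  shows "lin (eigproj X \<theta> d i)"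
proof -
  have "lin (foldr (\<lambda>j v. inverse (\<theta> i - \<theta> j) *s (X v - \<theta> j *s v)) js)" for js
    by (induction js)
       (auto simp: lin_iff lin_simps[OF assms] algebra_simps scale_right_distrib scale_right_diff_distrib)
  then show ?thesis by (simp add: eigproj_def[abs_def] del: upt_Suc)
qed

lemma eigproj_invariant:
  assumes "subspace W" "\<And>v. v \<in> W \<Longrightarrow> X v \<in> W" "v \<in> W"
  shows "eigproj X \<theta> d i v \<in> W"
proof -
  have "foldr (\<lambda>j v. inverse (\<theta> i - \<theta> j) *s (X v - \<theta> j *s v)) js v \<in> W" for js
    using assms by (induction js) (auto intro!: subspace_scale subspace_diff)
  then show ?thesis by (simp add: eigproj_def del: upt_Suc)
qed

text \<open>On this eigenvector the factor for \<open>j\<close> acts as (\<theta> k - \<theta> j) /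
  (\<theta> i - \<theta> j). All factors are 1 if \<open>k = i\<close>; otherwise the one with
  \<open>j = k\<close> vanishes.\<close>

lemma eigproj_eigen:
  assumes "graded X \<theta> d" "i \<le> d" "k \<le> d" "X v = \<theta> k *s v"
  shows "eigproj X \<theta> d i v = (if k = i then v else 0)"
proof -
  note L = lin_simps[OF graded_lin[OF assms(1)]]
  have *: "foldr (\<lambda>j v. inverse (\<theta> i - \<theta> j) *s (X v - \<theta> j *s v)) js v
      = (\<Prod>j\<leftarrow>js. inverse (\<theta> i - \<theta> j) * (\<theta> k - \<theta> j)) *s v" for js
    by (induction js)
       (auto simp: L assms(4) algebra_simps scale_left_diff_distrib scale_right_diff_distrib)
  let ?js = "filter (\<lambda>j. j \<noteq> i) [0..<Suc d]"
  have inj: "\<theta> i \<noteq> \<theta> j" if "j \<in> set ?js" for j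
    using that assms(1,2) by (auto simp: graded_def inj_on_def simp del: upt_Suc)
  have "(\<Prod>j\<leftarrow>?js. inverse (\<theta> i - \<theta> j) * (\<theta> k - \<theta> j)) = (if k = i then 1 else 0)"
  proof (cases "k = i")
    case True
    then have "map (\<lambda>j. inverse (\<theta> i - \<theta> j) * (\<theta> k - \<theta> j)) ?js = map (\<lambda>j. 1) ?js"
      using inj by (intro map_cong) auto
    then show ?thesis using True by (simp only: map_replicate_const prod_list_replicate) simp
  next
    case False
    then have "0 \<in> set (map (\<lambda>j. inverse (\<theta> i - \<theta> j) * (\<theta> k - \<theta> j)) ?js)"
      using assms(3) by (auto simp: image_iff simp del: upt_Suc intro!: exI[of _ k])
    then show ?thesis using False by (simp only: prod_list_zero_iff if_False)
  qed
  then show ?thesis using * by (simp add: eigproj_def del: upt_Suc)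
qed

lemma lin_eq_graded:
  assumes "graded X \<theta> d" "lin Y" "lin Z" "\<And>k v. k \<le> d \<Longrightarrow> X v = \<theta> k *s v \<Longrightarrow> Y v = Z v"
  shows "Y v = Z v"
proof (rule graded_induct[OF assms(1), where P = "\<lambda>v. Y v = Z v"])
  show "subspace {v. Y v = Z v}"
    by (auto simp: subspace_def lin_simps[OF assms(2)] lin_simps[OF assms(3)])
qed (rule assms(4))

lemma eigproj_in:
  assumes "graded X \<theta> d" "i \<le> d"
  shows "X (eigproj X \<theta> d i v) = \<theta> i *s eigproj X \<theta> d i v"
proof (rule lin_eq_graded[OF assms(1), where Y = "\<lambda>v. X (eigproj X \<theta> d i v)" and Z = "\<lambda>v. \<theta> i *s eigproj X \<theta> d i v"])
  note l = graded_lin[OF assms(1)]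
  note p = eigproj_lin[OF l, of \<theta> d i]
  show "lin (\<lambda>v. X (eigproj X \<theta> d i v))" using l p by (rule lin_compose)
  show "lin (\<lambda>v. \<theta> i *s eigproj X \<theta> d i v)" using p by (rule lin_scale)
  show "X (eigproj X \<theta> d i v) = \<theta> i *s eigproj X \<theta> d i v" if "k \<le> d" "X v = \<theta> k *s v" for k v
    using eigproj_eigen[OF assms that] that by (simp add: lin_simps(3)[OF l])
qed

lemma eigproj_app:
  assumes "graded X \<theta> d" "i \<le> d"
  shows "eigproj X \<theta> d i (X v) = \<theta> i *s eigproj X \<theta> d i v"
proof (rule lin_eq_graded[OF assms(1), where Y = "\<lambda>v. eigproj X \<theta> d i (X v)" and Z = "\<lambda>v. \<theta> i *s eigproj X \<theta> d i v"])
  note l = graded_lin[OF assms(1)]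
  note p = eigproj_lin[OF l, of \<theta> d i]
  show "lin (\<lambda>v. eigproj X \<theta> d i (X v))" using p l by (rule lin_compose)
  show "lin (\<lambda>v. \<theta> i *s eigproj X \<theta> d i v)" using p by (rule lin_scale)
  show "eigproj X \<theta> d i (X v) = \<theta> i *s eigproj X \<theta> d i v" if "k \<le> d" "X v = \<theta> k *s v" for k v
    using eigproj_eigen[OF assms that] that by (simp add: lin_simps(2)[OF p])
qed

lemma sum_eigproj:
  assumes "graded X \<theta> d"
  shows "(\<Sum>i\<le>d. eigproj X \<theta> d i v) = v"
proof -
  note p = eigproj_lin[OF graded_lin[OF assms], of \<theta> d]
  have "lin (\<lambda>v. \<Sum>i\<le>d. eigproj X \<theta> d i v)"
    by (simp add: lin_iff lin_simps[OF p] sum.distrib scale_sum_right)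
  moreover have "(\<Sum>i\<le>d. eigproj X \<theta> d i w) = w" if "k \<le> d" "X w = \<theta> k *s w" for k w
  proof -
    have "(\<Sum>i\<le>d. eigproj X \<theta> d i w) = (\<Sum>i\<le>d. if k = i then w else 0)"
      using that by (intro sum.cong) (auto simp: eigproj_eigen[OF assms])
    then show ?thesis using that by simp
  qed
  ultimately show ?thesis
    using lin_ident by (rule_tac lin_eq_graded[OF assms])
qed

text \<open>The projections serve as coordinates: later claims about sums of eigenspaces reduce to
  the vanishing of components.\<close>

lemma mem_ssum_eig:
  assumes "graded X \<theta> d" "I \<subseteq> {..d}"
  shows "v \<in> ssum scale (\<lambda>j. eig X (\<theta> j)) I \<longleftrightarrow> (\<forall>j\<le>d. j \<notin> I \<longrightarrow> eigproj X \<theta> d j v = 0)"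
proof
  assume v: "v \<in> ssum scale (\<lambda>j. eig X (\<theta> j)) I"
  show "\<forall>j\<le>d. j \<notin> I \<longrightarrow> eigproj X \<theta> d j v = 0"
  proof (intro allI impI)
    fix j assume j: "j \<le> d" "j \<notin> I"
    have "eigproj X \<theta> d j v \<in> {0}"
    proof (rule span_mapsto[OF eigproj_lin[OF graded_lin[OF assms(1)]] subspace_single_0])
      show "v \<in> span (\<Union>j\<in>I. eig X (\<theta> j))" using v by (simp add: ssum_def)
      show "eigproj X \<theta> d j w \<in> {0}" if "w \<in> (\<Union>j\<in>I. eig X (\<theta> j))" for w
      proof -
        obtain k where "k \<in> I" "X w = \<theta> k *s w" using \<open>w \<in> _\<close> by (auto simp: eigenspace_def)
        then show ?thesis using eigproj_eigen[OF assms(1) j(1), of k w] j assms(2) by auto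
      qed
    qed
    then show "eigproj X \<theta> d j v = 0" by simp
  qed
next
  assume *: "\<forall>j\<le>d. j \<notin> I \<longrightarrow> eigproj X \<theta> d j v = 0"
  have "(\<Sum>i\<le>d. eigproj X \<theta> d i v) \<in> span (\<Union>j\<in>I. eig X (\<theta> j))"
  proof (rule span_sum)
    fix i assume i: "i \<in> {..d}"
    show "eigproj X \<theta> d i v \<in> span (\<Union>j\<in>I. eig X (\<theta> j))"
    proof (cases "i \<in> I")
      case True
      then have "eigproj X \<theta> d i v \<in> (\<Union>j\<in>I. eig X (\<theta> j))"
        using eigproj_in[OF assms(1)] i by (auto simp: eigenspace_def)
      then show ?thesis by (rule span_base)
    qed (use * i in \<open>auto intro: span_zero\<close>)
  qed
  then show "v \<in> ssum scale (\<lambda>j. eig X (\<theta> j)) I"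
    using sum_eigproj[OF assms(1)] by (simp add: ssum_def)
qed

lemma eigproj_eqI:
  assumes "graded X \<theta> d" "i \<le> d"
  shows "v \<in> eig X (\<theta> i) \<longleftrightarrow> (\<forall>j\<le>d. j \<noteq> i \<longrightarrow> eigproj X \<theta> d j v = 0)"
proof -
  have "ssum scale (\<lambda>j. eig X (\<theta> j)) {i} = eig X (\<theta> i)"
    using subspace_eig[OF graded_lin[OF assms(1)]] by (simp add: ssum_def)
  then show ?thesis using mem_ssum_eig[OF assms(1), of "{i}" v] assms(2) by simp
qed

text \<open>Some component of an eigenvector is nonzero, and \<open>X\<close> scales it both by
  \<open>\<mu>\<close> and by the corresponding \<open>\<theta> i\<close>.\<close>

lemma graded_eigenvalue:
  assumes "graded X \<theta> d" "is_eigenvalue scale X \<mu>"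
  shows "\<mu> \<in> \<theta> ` {..d}"
proof -
  have "0 \<in> eig X \<mu>" using graded_lin[OF assms(1)] by (simp add: eigenspace_def lin_simps)
  then obtain v where v: "X v = \<mu> *s v" "v \<noteq> 0"
    using assms(2) by (auto simp: is_eigenvalue_def eigenspace_def)
  obtain i where i: "i \<le> d" "eigproj X \<theta> d i v \<noteq> 0"
    using sum_eigproj[OF assms(1), of v] v(2) by (metis sum.neutral atMost_iff)
  have "\<theta> i *s eigproj X \<theta> d i v = \<mu> *s eigproj X \<theta> d i v"
    using eigproj_app[OF assms(1) i(1), of v] v(1) lin_simps(2)[OF eigproj_lin[OF graded_lin[OF assms(1)]]]
    by metis
  then show ?thesis using i by auto
qed

lemma gradedI_standard:
  assumes "lin X" "diagonalizable scale X" "standard_eigenvalue_ordering scale X Y d \<theta>"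
  shows "graded X \<theta> d"
proof -
  have "eig X \<mu> \<subseteq> span (\<Union>i\<in>{..d}. eig X (\<theta> i))" for \<mu>
  proof (cases "is_eigenvalue scale X \<mu>")
    case True
    then have "eig X \<mu> \<subseteq> (\<Union>i\<in>{..d}. eig X (\<theta> i))"
      using assms(3) by (auto simp: standard_eigenvalue_ordering_def)
    then show ?thesis using span_superset by blast
  qed (auto simp: is_eigenvalue_def intro: span_zero)
  then have "span (\<Union>\<mu>. eig X \<mu>) \<subseteq> span (\<Union>i\<in>{..d}. eig X (\<theta> i))"
    by (intro span_minimal) auto
  then show ?thesis
    using assms by (auto simp: graded_def diagonalizable_def standard_eigenvalue_ordering_def)
qed

lemma graded_diagonalizable:
  assumes "graded X \<theta> d"
  shows "diagonalizable scale X"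
  using span_mono[of "\<Union>i\<in>{..d}. eig X (\<theta> i)" "\<Union>\<mu>. eig X \<mu>"] assms
  by (auto simp: graded_def diagonalizable_def)

text \<open>The projection fixes \<open>Z i\<close> and kills the other \<open>Z k\<close>, so it
  maps everything into \<open>Z i\<close>, while fixing each eigenvector for
  \<open>\<theta> i\<close>. This identifies the eigenspaces of \<open>B\<close> with the split
  components.\<close>

lemma eig_eq_of_span:
  assumes "graded X \<theta> d" "\<And>i. i \<le> d \<Longrightarrow> subspace (Z i)" "\<And>i. i \<le> d \<Longrightarrow> Z i \<subseteq> eig X (\<theta> i)"
    "span (\<Union>i\<in>{..d}. Z i) = UNIV" "i \<le> d"
  shows "eig X (\<theta> i) = Z i"
proof (intro equalityI subsetI)
  fix v assume v: "v \<in> eig X (\<theta> i)"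
  have "eigproj X \<theta> d i v \<in> Z i"
  proof (rule span_mapsto[OF eigproj_lin[OF graded_lin[OF assms(1)]] assms(2)[OF assms(5)]])
    show "v \<in> span (\<Union>i\<in>{..d}. Z i)" using assms(4) by simp
    show "eigproj X \<theta> d i w \<in> Z i" if w: "w \<in> (\<Union>i\<in>{..d}. Z i)" for w
    proof -
      obtain k where "k \<le> d" "w \<in> Z k" "X w = \<theta> k *s w"
        using w assms(3) by (force simp: eigenspace_def)
      then show ?thesis
        using eigproj_eigen[OF assms(1,5), of k w] subspace_0[OF assms(2)[OF assms(5)]] by auto
    qed
  qed
  then show "v \<in> Z i" using v eigproj_eigen[OF assms(1,5,5), of v] by (simp add: eigenspace_def)
qed (use assms in blast)

section \<open>Flags of partial sums of eigenspaces\<close>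

text \<open>The index is an integer so that shifts by one need no boundary cases. The opposite flag is
  the flag of the reversed ordering \<open>\<lambda>j. \<theta> (d - j)\<close>.\<close>

definition flag :: "('b \<Rightarrow> 'b) \<Rightarrow> (nat \<Rightarrow> 'a) \<Rightarrow> nat \<Rightarrow> int \<Rightarrow> 'b set" where
  "flag X \<theta> d i = ssum scale (\<lambda>j. eig X (\<theta> j)) {j. j \<le> d \<and> int j \<le> i}"

lemma mem_flag:
  assumes "graded X \<theta> d"
  shows "v \<in> flag X \<theta> d i \<longleftrightarrow> (\<forall>j\<le>d. i < int j \<longrightarrow> eigproj X \<theta> d j v = 0)"
  unfolding flag_def by (subst mem_ssum_eig[OF assms]) auto

lemma subspace_flag: "subspace (flag X \<theta> d i)"
  by (simp add: flag_def ssum_def)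

lemma flag_mono: "i \<le> j \<Longrightarrow> flag X \<theta> d i \<subseteq> flag X \<theta> d j"
  unfolding flag_def ssum_def by (intro span_mono) auto

lemma flag_top: "graded X \<theta> d \<Longrightarrow> int d \<le> i \<Longrightarrow> flag X \<theta> d i = UNIV"
  by (auto simp: mem_flag)

lemma flag_bot:
  assumes "i < 0" shows "flag X \<theta> d i = {0}"
proof -
  have *: "{j. j \<le> d \<and> int j \<le> i} = {}" using assms by auto
  show ?thesis by (simp add: flag_def ssum_def * del: Collect_empty_eq)
qed

lemma flag_eigen:
  assumes "graded X \<theta> d" "k \<le> d" "v \<in> eig X (\<theta> k)" "int k \<le> i"
  shows "v \<in> flag X \<theta> d i"
  using assms(3,4) by (auto simp: mem_flag[OF assms(1)] eigproj_eqI[OF assms(1,2)])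

lemma flag_step:
  assumes "graded X \<theta> d" "k \<le> d" "v \<in> flag X \<theta> d (int k)"
  shows "X v - \<theta> k *s v \<in> flag X \<theta> d (int k - 1)"
proof -
  note p = lin_simps[OF eigproj_lin[OF graded_lin[OF assms(1)]]]
  have "eigproj X \<theta> d j (X v - \<theta> k *s v) = 0" if "j \<le> d" "int k - 1 < int j" for j
  proof -
    have "eigproj X \<theta> d j (X v - \<theta> k *s v) = (\<theta> j - \<theta> k) *s eigproj X \<theta> d j v"
      using that by (simp add: p eigproj_app[OF assms(1)] scale_left_diff_distrib)
    also have "\<dots> = 0"
      using that assms(3) by (cases "j = k") (auto simp: mem_flag[OF assms(1)])
    finally show ?thesis .
  qed
  then show ?thesis by (simp add: mem_flag[OF assms(1)])
qed

text \<open>Outside the range from 0 to \<open>d\<close> any scalar works: the flag is zero, or it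
  and its predecessor are everything. This spares the ladder argument its boundary cases.\<close>

lemma flag_step_ex:
  assumes "graded X \<theta> d"
  shows "\<exists>c. \<forall>v\<in>flag X \<theta> d i. X v - c *s v \<in> flag X \<theta> d (i - 1)"
proof -
  consider "i < 0" | k where "k \<le> d" "i = int k" | "int d < i"
    by (metis nonneg_int_cases not_less of_nat_le_iff)
  then show ?thesis
  proof cases
    case 1 then show ?thesis
      using lin_simps(3)[OF graded_lin[OF assms]] by (simp add: flag_bot)
  next
    case 2 then show ?thesis using flag_step[OF assms] by blast
  next
    case 3 then show ?thesis using flag_top[OF assms] by simp
  qed
qed

lemma graded_rev:
  assumes "graded X \<theta> d"
  shows "graded X (\<lambda>j. \<theta> (d - j)) d"
proof -
  have inj: "inj_on (\<lambda>j. d - j) {..d}" by (rule inj_onI) auto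
  have img: "(\<lambda>j. d - j) ` {..d} = {..d}"
    by (rule endo_inj_surj[OF _ _ inj]) auto
  have "(\<Union>i\<in>{..d}. eig X (\<theta> (d - i))) = (\<Union>i\<in>(\<lambda>j. d - j) ` {..d}. eig X (\<theta> i))"
    by (simp only: image_image)
  moreover have "inj_on (\<theta> \<circ> (\<lambda>j. d - j)) {..d}"
    using assms inj by (intro comp_inj_on) (simp_all only: img graded_def)
  ultimately show ?thesis using assms by (simp add: graded_def img comp_def)
qed

lemma flag_rev:
  assumes "graded X \<theta> d"
  shows "v \<in> flag X (\<lambda>j. \<theta> (d - j)) d i \<longleftrightarrow> (\<forall>j\<le>d. int j < int d - i \<longrightarrow> eigproj X \<theta> d j v = 0)"
proof -
  have "(\<lambda>j. d - j) ` {j. j \<le> d \<and> int j \<le> i} = {j. j \<le> d \<and> int d - i \<le> int j}"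
  proof (intro equalityI subsetI)
    fix j assume "j \<in> {j. j \<le> d \<and> int d - i \<le> int j}"
    then show "j \<in> (\<lambda>j. d - j) ` {j. j \<le> d \<and> int j \<le> i}"
      by (intro image_eqI[of _ _ "d - j"]) auto
  qed auto
  moreover have "flag X (\<lambda>j. \<theta> (d - j)) d i
      = ssum scale (\<lambda>j. eig X (\<theta> j)) ((\<lambda>j. d - j) ` {j. j \<le> d \<and> int j \<le> i})"
    by (simp only: flag_def ssum_def image_image)
  ultimately have *: "flag X (\<lambda>j. \<theta> (d - j)) d i = ssum scale (\<lambda>j. eig X (\<theta> j)) {j. j \<le> d \<and> int d - i \<le> int j}"
    by simp
  show ?thesis unfolding * by (subst mem_ssum_eig[OF assms]) auto
qed

lemma flag_rev_rev: "flag X (\<lambda>j. \<theta> (d - (d - j))) d i = flag X \<theta> d i"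
proof -
  have "(\<Union>j\<in>{j. j \<le> d \<and> int j \<le> i}. eig X (\<theta> (d - (d - j)))) = (\<Union>j\<in>{j. j \<le> d \<and> int j \<le> i}. eig X (\<theta> j))"
    by (intro SUP_cong) auto
  then show ?thesis by (simp only: flag_def ssum_def)
qed

lemma flag_rev_disjoint:
  assumes "graded X \<theta> d" "i + j < int d"
  shows "flag X \<theta> d i \<inter> flag X (\<lambda>j. \<theta> (d - j)) d j = {0}"
proof -
  have "v = 0" if v: "v \<in> flag X \<theta> d i" "v \<in> flag X (\<lambda>j. \<theta> (d - j)) d j" for v
  proof -
    have "eigproj X \<theta> d k v = 0" if "k \<le> d" for k
      using v that assms(2) unfolding mem_flag[OF assms(1)] flag_rev[OF assms(1)]
      by (cases "i < int k") auto
    then show ?thesis using sum_eigproj[OF assms(1), of v] by simp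
  qed
  then show ?thesis using subspace_0[OF subspace_flag] by blast
qed

text \<open>For \<open>i\<close> between 0 and \<open>d\<close> the opposite flags meet inside the
  eigenspace with index \<open>i\<close>; for other \<open>i\<close> one of them is zero.\<close>

lemma flag_rev_scalar:
  assumes "graded X \<theta> d" "v \<in> flag X \<theta> d i" "v \<in> flag X (\<lambda>j. \<theta> (d - j)) d (int d - i)"
  shows "\<exists>c. X v = c *s v"
proof (cases "0 \<le> i \<and> i \<le> int d")
  case True
  then obtain k where k: "i = int k" "k \<le> d" by (metis nonneg_int_cases of_nat_le_iff)
  have "eigproj X \<theta> d j v = 0" if "j \<le> d" "j \<noteq> k" for j
    using assms(2,3) that unfolding mem_flag[OF assms(1)] flag_rev[OF assms(1)] k(1)
    by (cases "j < k") auto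
  then have "v \<in> eig X (\<theta> k)" using eigproj_eqI[OF assms(1) k(2)] by blast
  then show ?thesis by (auto simp: eigenspace_def)
next
  case False
  then have "v = 0" using assms(2,3) flag_bot[of i] flag_bot[of "int d - i"] by fastforce
  then show ?thesis by (simp add: lin_simps[OF graded_lin[OF assms(1)]])
qed

lemma flag_mapsto:
  assumes "graded X \<theta> d" "lin Y"
    and "\<And>k v. k < d \<Longrightarrow> v \<in> eig X (\<theta> k) \<Longrightarrow> Y v \<in> flag X \<theta> d (int k + 1)"
    and "v \<in> flag X \<theta> d i"
  shows "Y v \<in> flag X \<theta> d (i + 1)"
proof (rule span_mapsto[OF assms(2) subspace_flag])
  show "v \<in> span (\<Union>j\<in>{j. j \<le> d \<and> int j \<le> i}. eig X (\<theta> j))"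
    using assms(4) by (simp add: flag_def ssum_def)
  fix w assume "w \<in> (\<Union>j\<in>{j. j \<le> d \<and> int j \<le> i}. eig X (\<theta> j))"
  then obtain k where k: "k \<le> d" "int k \<le> i" "w \<in> eig X (\<theta> k)" by blast
  then show "Y w \<in> flag X \<theta> d (i + 1)"
  proof (cases "k < d")
    case True
    then show ?thesis using assms(3)[OF True k(3)] flag_mono[of "int k + 1" "i + 1"] k by auto
  qed (use k flag_top[OF assms(1)] in auto)
qed

text \<open>At \<open>j > k + 1\<close> the component of \<open>Y v\<close> times the nonzero scalar
  \<theta> j - \<theta> (k + 1) is a component of a vector of eigenspace \<open>k\<close>, hence
  zero. This turns the q-commutation relations into bounds on flags.\<close>

lemma flag_mapsto_relation:
  assumes "graded X \<theta> d" "lin Y"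
    and "\<And>k v. k < d \<Longrightarrow> v \<in> eig X (\<theta> k) \<Longrightarrow> X (Y v) - \<theta> (Suc k) *s Y v \<in> eig X (\<theta> k)"
    and "v \<in> flag X \<theta> d i"
  shows "Y v \<in> flag X \<theta> d (i + 1)"
proof (rule flag_mapsto[OF assms(1,2) _ assms(4)])
  fix k v assume k: "k < d" "v \<in> eig X (\<theta> k)"
  have "eigproj X \<theta> d j (Y v) = 0" if j: "j \<le> d" "Suc k < j" for j
  proof -
    note p = lin_simps[OF eigproj_lin[OF graded_lin[OF assms(1)]]]
    have "(\<theta> j - \<theta> (Suc k)) *s eigproj X \<theta> d j (Y v) = eigproj X \<theta> d j (X (Y v) - \<theta> (Suc k) *s Y v)"
      using j by (simp add: p eigproj_app[OF assms(1)] scale_left_diff_distrib)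
    also have "\<dots> = 0"
      using assms(3)[OF k] k j by (subst (asm) eigproj_eqI[OF assms(1)]) auto
    finally show ?thesis
      using j k inj_onD[of \<theta> "{..d}" j "Suc k"] assms(1) by (auto simp: graded_def)
  qed
  then show "Y v \<in> flag X \<theta> d (int k + 1)" by (auto simp: mem_flag[OF assms(1)])
qed

section \<open>Tridiagonality in terms of flags\<close>

lemma standard_flag:
  assumes "graded X \<theta> d" "lin Y" "standard_eigenvalue_ordering scale X Y d \<theta>" "v \<in> flag X \<theta> d i"
  shows "Y v \<in> flag X \<theta> d (i + 1)"
proof (rule flag_mapsto[OF assms(1,2) _ assms(4)])
  fix k v assume "k < d" "v \<in> eig X (\<theta> k)"
  then have "Y v \<in> ssum scale (\<lambda>j. eig X (\<theta> j)) {j. j \<le> d \<and> k \<le> j + 1 \<and> j \<le> k + 1}"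
    using assms(3) unfolding standard_eigenvalue_ordering_def by (meson image_subset_iff less_imp_le)
  then show "Y v \<in> flag X \<theta> d (int k + 1)"
    unfolding flag_def ssum_def by (rule set_mp[OF span_mono[OF UN_mono], rotated 2]) auto
qed

text \<open>Index reversal preserves the neighbour relation; thus \<open>standard_flag\<close> also
  applies to the opposite flags.\<close>

lemma standard_rev:
  assumes "standard_eigenvalue_ordering scale X Y d \<theta>"
  shows "standard_eigenvalue_ordering scale X Y d (\<lambda>j. \<theta> (d - j))"
proof -
  have st: "inj_on \<theta> {..d}" "\<And>i. i \<le> d \<Longrightarrow> is_eigenvalue scale X (\<theta> i)"
    "\<And>\<mu>. is_eigenvalue scale X \<mu> \<Longrightarrow> \<mu> \<in> \<theta> ` {..d}"
    "\<And>i v. i \<le> d \<Longrightarrow> v \<in> eig X (\<theta> i) \<Longrightarrow>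
      Y v \<in> ssum scale (\<lambda>j. eig X (\<theta> j)) {j. j \<le> d \<and> i \<le> j + 1 \<and> j \<le> i + 1}"
    using assms unfolding standard_eigenvalue_ordering_def by blast+
  have "inj_on (\<lambda>j. \<theta> (d - j)) {..d}"
  proof (rule inj_onI)
    fix x y assume "x \<in> {..d}" "y \<in> {..d}" "\<theta> (d - x) = \<theta> (d - y)"
    moreover from this have "d - x = d - y" by (intro inj_onD[OF st(1)]) auto
    ultimately show "x = y" by auto
  qed
  moreover have "\<mu> \<in> (\<lambda>j. \<theta> (d - j)) ` {..d}" if "is_eigenvalue scale X \<mu>" for \<mu>
  proof -
    obtain j where "j \<le> d" "\<mu> = \<theta> j" using st(3)[OF \<open>is_eigenvalue scale X \<mu>\<close>] by auto
    then show ?thesis by (intro image_eqI[of _ _ "d - j"]) auto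
  qed
  moreover have "Y v \<in> ssum scale (\<lambda>j. eig X (\<theta> (d - j))) {j. j \<le> d \<and> i \<le> j + 1 \<and> j \<le> i + 1}"
    if i: "i \<le> d" "v \<in> eig X (\<theta> (d - i))" for i v
  proof -
    have "(\<Union>j\<in>{j. j \<le> d \<and> d - i \<le> j + 1 \<and> j \<le> d - i + 1}. eig X (\<theta> j))
        \<subseteq> (\<Union>j\<in>{j. j \<le> d \<and> i \<le> j + 1 \<and> j \<le> i + 1}. eig X (\<theta> (d - j)))"
    proof (rule UN_least)
      fix j assume "j \<in> {j. j \<le> d \<and> d - i \<le> j + 1 \<and> j \<le> d - i + 1}"
      then have "d - j \<in> {j. j \<le> d \<and> i \<le> j + 1 \<and> j \<le> i + 1}" "d - (d - j) = j"
        using i by auto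
      then show "eig X (\<theta> j) \<subseteq> (\<Union>j\<in>{j. j \<le> d \<and> i \<le> j + 1 \<and> j \<le> i + 1}. eig X (\<theta> (d - j)))"
        by (metis (lifting) UN_upper)
    qed
    from span_mono[OF this] show ?thesis
      using st(4)[OF _ i(2)] unfolding ssum_def by auto
  qed
  ultimately show ?thesis
    using st(2) unfolding standard_eigenvalue_ordering_def by auto
qed

text \<open>An eigenspace lies in two opposite flags, so its image has components only at indices
  from \<open>i - 1\<close> to \<open>i + 1\<close>.\<close>

lemma standardI_flag:
  assumes "graded X \<theta> d" "\<And>i. i \<le> d \<Longrightarrow> is_eigenvalue scale X (\<theta> i)"
    and "\<And>v i. v \<in> flag X \<theta> d i \<Longrightarrow> Y v \<in> flag X \<theta> d (i + 1)"
    and "\<And>v i. v \<in> flag X (\<lambda>j. \<theta> (d - j)) d i \<Longrightarrow> Y v \<in> flag X (\<lambda>j. \<theta> (d - j)) d (i + 1)"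
  shows "standard_eigenvalue_ordering scale X Y d \<theta>"
proof -
  have "Y v \<in> ssum scale (\<lambda>j. eig X (\<theta> j)) {j. j \<le> d \<and> i \<le> j + 1 \<and> j \<le> i + 1}"
    if i: "i \<le> d" "v \<in> eig X (\<theta> i)" for i v
  proof -
    have "v \<in> flag X \<theta> d i" "v \<in> flag X (\<lambda>j. \<theta> (d - j)) d (int d - int i)"
      using i by (auto simp: mem_flag[OF assms(1)] flag_rev[OF assms(1)] eigproj_eqI[OF assms(1) i(1)])
    then have *: "Y v \<in> flag X \<theta> d (int i + 1)" "Y v \<in> flag X (\<lambda>j. \<theta> (d - j)) d (int d - int i + 1)"
      by (auto intro: assms(3,4))
    show ?thesis
    proof (subst mem_ssum_eig[OF assms(1)])
      show "\<forall>j\<le>d. j \<notin> {j. j \<le> d \<and> i \<le> j + 1 \<and> j \<le> i + 1} \<longrightarrow> eigproj X \<theta> d j (Y v) = 0"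
        using * by (auto simp: mem_flag[OF assms(1)] flag_rev[OF assms(1)] not_le)
    qed auto
  qed
  then show ?thesis
    using assms(1,2) graded_eigenvalue[OF assms(1)]
    unfolding standard_eigenvalue_ordering_def graded_def by blast
qed

text \<open>The reverse inclusion descends from index \<open>d\<close>. A vector of
  \<open>F (k - 1)\<close> lies in the flag at \<open>k\<close>, and its component at
  \<open>k\<close> is a difference of two vectors of \<open>F (k - 1)\<close>, hence zero by the
  intersection hypothesis.\<close>

lemma flag_eqI:
  assumes "graded X \<theta> d" "\<And>i. subspace (F i)" "\<And>i j. i \<le> j \<Longrightarrow> F i \<subseteq> F j"
    and "\<And>k. k \<le> d \<Longrightarrow> eig X (\<theta> k) \<subseteq> F (int k)"
    and "\<And>k. k \<le> d \<Longrightarrow> F (int k - 1) \<inter> eig X (\<theta> k) = {0}"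
  shows "flag X \<theta> d i = F i"
proof
  have sub: "flag X \<theta> d i \<subseteq> F i" for i
    unfolding flag_def ssum_def using assms(3,4) by (intro span_minimal assms(2)) fast
  then show "flag X \<theta> d i \<subseteq> F i" .
  \<comment> \<open>Running up to \<open>n = d + 1\<close> reaches index -1 and so settles all
    negative indices.\<close>
  have down: "F (int d - int n) \<subseteq> flag X \<theta> d (int d - int n)" if "n \<le> d + 1" for n
    using that
  proof (induction n)
    case 0
    then show ?case using flag_top[OF assms(1)] by auto
  next
    case (Suc n)
    define k where "k = d - n"
    then have k: "k \<le> d" "int k = int d - int n" "int d - int (Suc n) = int k - 1" using Suc.prems by auto
    show ?case unfolding k(3)
    proof
      fix v assume v: "v \<in> F (int k - 1)"
      have vk: "v \<in> flag X \<theta> d (int k)"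
        using Suc v assms(3)[of "int k - 1" "int k"] k by auto
      let ?u = "eigproj X \<theta> d k v"
      have u: "?u \<in> eig X (\<theta> k)" using eigproj_in[OF assms(1) k(1)] by (simp add: eigenspace_def)
      have "v - ?u \<in> flag X \<theta> d (int k - 1)"
      proof (subst mem_flag[OF assms(1)], intro allI impI)
        fix j assume j: "j \<le> d" "int k - 1 < int j"
        have "eigproj X \<theta> d j (v - ?u) = eigproj X \<theta> d j v - (if k = j then ?u else 0)"
          using eigproj_eigen[OF assms(1) j(1) k(1)] u
          by (simp add: eigenspace_def lin_simps[OF eigproj_lin[OF graded_lin[OF assms(1)]]])
        then show "eigproj X \<theta> d j (v - ?u) = 0"
          using vk j by (auto simp: mem_flag[OF assms(1)])
      qed
      moreover from this have "v - (v - ?u) \<in> F (int k - 1)"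
          using sub by (rule_tac subspace_diff[OF assms(2) v]) blast
      then have "?u = 0" using u assms(5)[OF k(1)] by auto
      ultimately show "v \<in> flag X \<theta> d (int k - 1)" by simp
    qed
  qed
  consider "int d < i" | "i < 0" | "0 \<le> i" "i \<le> int d" by linarith
  then show "F i \<subseteq> flag X \<theta> d i"
  proof cases
    case 1
    then show ?thesis using flag_top[OF assms(1)] by auto
  next
    case 2
    then have "F i \<subseteq> flag X \<theta> d (-1)" using down[of "d + 1"] assms(3)[of i "-1"] by auto
    then show ?thesis using 2 subspace_0[OF assms(2)] by (simp add: flag_bot)
  next
    case 3
    then show ?thesis using down[of "d - nat i"] by (simp add: of_nat_diff nat_le_iff)
  qed
qed

section \<open>Ladders of intersections of two flags\<close>

text \<open>\<open>X\<close> minus a scalar lowers the first flag by one and raises the second by at most one, and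
  vice versa for \<open>Y\<close>; so for each \<open>n\<close> the following space is invariant under both.\<close>

definition ladder where
  "ladder X \<theta> Y \<phi> d W n = span (\<Union>i. W \<inter> flag X \<theta> d i \<inter> flag Y \<phi> d (n - i))"

lemma ladder_trivial:
  assumes "graded X \<theta> d" "graded Y \<phi> d"
    and YX: "\<And>v i. v \<in> flag X \<theta> d i \<Longrightarrow> Y v \<in> flag X \<theta> d (i + 1)"
    and XY: "\<And>v i. v \<in> flag Y \<phi> d i \<Longrightarrow> X v \<in> flag Y \<phi> d (i + 1)"
    and W: "subspace W" "X ` W \<subseteq> W" "Y ` W \<subseteq> W"
    and irr: "\<And>S. subspace S \<Longrightarrow> S \<subseteq> W \<Longrightarrow> X ` S \<subseteq> S \<Longrightarrow> Y ` S \<subseteq> S \<Longrightarrow> S = {0} \<or> S = W"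
  shows "ladder X \<theta> Y \<phi> d W n = {0} \<or> ladder X \<theta> Y \<phi> d W n = W"
proof (rule irr)
  let ?L = "ladder X \<theta> Y \<phi> d W n"
  show L: "subspace ?L" by (simp add: ladder_def)
  show "?L \<subseteq> W" unfolding ladder_def by (rule span_minimal) (use W in auto)
  have base: "v \<in> ?L" if "v \<in> W" "v \<in> flag X \<theta> d i" "v \<in> flag Y \<phi> d j" "i + j = n" for v i j
    unfolding ladder_def using that by (intro span_base) (auto intro!: exI[of _ i])
  have "X v \<in> ?L" if "v \<in> ?L" for v
  proof (rule span_mapsto[OF graded_lin[OF assms(1)] L _ that[unfolded ladder_def]])
    fix w assume "w \<in> (\<Union>i. W \<inter> flag X \<theta> d i \<inter> flag Y \<phi> d (n - i))"
    then obtain i where w: "w \<in> W" "w \<in> flag X \<theta> d i" "w \<in> flag Y \<phi> d (n - i)" by blast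
    \<comment> \<open>The scalar part is split off: \<open>X w - c *s w\<close> passes to rung
      \<open>i - 1\<close>, while \<open>c *s w\<close> stays in rung \<open>i\<close>.\<close>
    obtain c where c: "X w - c *s w \<in> flag X \<theta> d (i - 1)" using flag_step_ex[OF assms(1)] w by blast
    have "w \<in> flag Y \<phi> d (n - i + 1)" using w flag_mono[of "n - i" "n - i + 1"] by auto
    then have "X w - c *s w \<in> flag Y \<phi> d (n - i + 1)"
      using XY[OF w(3)] by (intro subspace_diff subspace_scale subspace_flag)
    moreover have "X w - c *s w \<in> W" using W w by (intro subspace_diff subspace_scale) auto
    ultimately have "X w - c *s w \<in> ?L" using c by (rule_tac base) auto
    moreover have "c *s w \<in> ?L" using w by (intro subspace_scale[OF L] base) auto
    ultimately have "(X w - c *s w) + c *s w \<in> ?L" by (rule subspace_add[OF L])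
    then show "X w \<in> ?L" by simp
  qed
  then show "X ` ?L \<subseteq> ?L" by blast
  have "Y v \<in> ?L" if "v \<in> ?L" for v
  proof (rule span_mapsto[OF graded_lin[OF assms(2)] L _ that[unfolded ladder_def]])
    fix w assume "w \<in> (\<Union>i. W \<inter> flag X \<theta> d i \<inter> flag Y \<phi> d (n - i))"
    then obtain i where w: "w \<in> W" "w \<in> flag X \<theta> d i" "w \<in> flag Y \<phi> d (n - i)" by blast
    obtain c where c: "Y w - c *s w \<in> flag Y \<phi> d (n - i - 1)" using flag_step_ex[OF assms(2)] w by blast
    have "w \<in> flag X \<theta> d (i + 1)" using w flag_mono[of "i" "i + 1"] by auto
    then have "Y w - c *s w \<in> flag X \<theta> d (i + 1)"
      using YX[OF w(2)] by (intro subspace_diff subspace_scale subspace_flag)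
    moreover have "Y w - c *s w \<in> W" using W w by (intro subspace_diff subspace_scale) auto
    ultimately have "Y w - c *s w \<in> ?L" using c by (rule_tac base) auto
    moreover have "c *s w \<in> ?L" using w by (intro subspace_scale[OF L] base) auto
    ultimately have "(Y w - c *s w) + c *s w \<in> ?L" by (rule subspace_add[OF L])
    then show "Y w \<in> ?L" by simp
  qed
  then show "Y ` ?L \<subseteq> ?L" by blast
qed

lemma ladder_eq:
  assumes "ladder X \<theta> Y \<phi> d W n = {0} \<or> ladder X \<theta> Y \<phi> d W n = W"
    and "v \<in> W" "v \<in> flag X \<theta> d i" "v \<in> flag Y \<phi> d j" "i + j = n" "v \<noteq> 0"
  shows "ladder X \<theta> Y \<phi> d W n = W"
proof -
  have "v \<in> W \<inter> flag X \<theta> d i \<inter> flag Y \<phi> d (n - i)" using assms(2-5) by auto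
  then have "v \<in> ladder X \<theta> Y \<phi> d W n" unfolding ladder_def by (blast intro: span_base)
  then show ?thesis using assms(1,6) by blast
qed

text \<open>For \<open>n < d\<close> every summand is zero by \<open>flag_rev_disjoint\<close>; for
  \<open>n = d\<close> every vector of a summand is scaled by \<open>X\<close>.\<close>

lemma ladder_rev:
  assumes "graded X \<theta> d" "subspace W" "W \<noteq> {0}"
    and "span (\<Union>i. W \<inter> flag X \<theta> d i \<inter> flag X (\<lambda>j. \<theta> (d - j)) d (n - i)) = W"
  shows "int d \<le> n" "n = int d \<Longrightarrow> X ` W \<subseteq> W"
proof -
  show "int d \<le> n"
  proof (rule ccontr)
    assume "\<not> int d \<le> n"
    then have "flag X \<theta> d i \<inter> flag X (\<lambda>j. \<theta> (d - j)) d (n - i) = {0}" for i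
      by (intro flag_rev_disjoint[OF assms(1)]) auto
    then have "span (\<Union>i. W \<inter> flag X \<theta> d i \<inter> flag X (\<lambda>j. \<theta> (d - j)) d (n - i)) \<subseteq> {0}"
      by (intro span_minimal) auto
    then show False using assms(2-4) subspace_0 by blast
  qed
  assume n: "n = int d"
  have "X v \<in> W" if "v \<in> W" for v
  proof (rule span_mapsto[OF graded_lin[OF assms(1)] assms(2)])
    show "v \<in> span (\<Union>i. W \<inter> flag X \<theta> d i \<inter> flag X (\<lambda>j. \<theta> (d - j)) d (n - i))"
      using that assms(4) by simp
    show "X w \<in> W" if "w \<in> (\<Union>i. W \<inter> flag X \<theta> d i \<inter> flag X (\<lambda>j. \<theta> (d - j)) d (n - i))" for w
      using that flag_rev_scalar[OF assms(1)] subspace_scale[OF assms(2)] unfolding n by fastforce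
  qed
  then show "X ` W \<subseteq> W" by blast
qed

text \<open>\<open>m\<close> is the largest index whose projection is nonzero on \<open>W\<close>,
  and \<open>v\<close> is a value of that projection. It stays in \<open>W\<close> because the
  projection is a polynomial in \<open>X\<close>.\<close>

lemma invariant_top_index:
  assumes "graded X \<theta> d" "subspace W" "X ` W \<subseteq> W" "W \<noteq> {0}"
  obtains m v where "m \<le> d" "W \<subseteq> flag X \<theta> d (int m)"
    "v \<in> W" "v \<in> flag X (\<lambda>j. \<theta> (d - j)) d (int d - int m)" "v \<noteq> 0"
proof -
  define I where "I = {i. i \<le> d \<and> (\<exists>v\<in>W. eigproj X \<theta> d i v \<noteq> 0)}"
  have fin: "finite I" unfolding I_def by auto
  obtain w where w: "w \<in> W" "w \<noteq> 0" using assms(2,4) subspace_0 by blast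
  then obtain i where "i \<le> d" "eigproj X \<theta> d i w \<noteq> 0"
    using sum_eigproj[OF assms(1), of w] by (metis sum.neutral atMost_iff)
  then have "I \<noteq> {}" using w by (auto simp: I_def)
  then have m: "Max I \<in> I" "\<And>j. j \<in> I \<Longrightarrow> j \<le> Max I" using fin by auto
  then obtain v where v: "v \<in> W" "eigproj X \<theta> d (Max I) v \<noteq> 0" "Max I \<le> d" by (auto simp: I_def)
  let ?u = "eigproj X \<theta> d (Max I) v"
  have "?u \<in> eig X (\<theta> (Max I))" using eigproj_in[OF assms(1) v(3)] by (simp add: eigenspace_def)
  then have "?u \<in> flag X (\<lambda>j. \<theta> (d - j)) d (int d - int (Max I))"
    using v(3) by (auto simp: flag_rev[OF assms(1)] eigproj_eqI[OF assms(1) v(3)])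
  moreover have "W \<subseteq> flag X \<theta> d (int (Max I))"
  proof
    fix x assume x: "x \<in> W"
    have "eigproj X \<theta> d j x = 0" if "j \<le> d" "int (Max I) < int j" for j
    proof (rule ccontr)
      assume "eigproj X \<theta> d j x \<noteq> 0"
      then have "j \<in> I" using x that by (auto simp: I_def)
      then show False using m(2) that by force
    qed
    then show "x \<in> flag X \<theta> d (int (Max I))" by (simp add: mem_flag[OF assms(1)])
  qed
  moreover have "?u \<in> W" using assms(2,3) v(1) by (intro eigproj_invariant) auto
  ultimately show ?thesis using that v by blast
qed

end

section \<open>The split decomposition and the map \<open>B\<close>\<close>

text \<open>The situation of the theorem with \<open>Q = q\<^sup>2\<close>. Reversing both eigenvalue orderings and
  replacing \<open>Q\<close> by \<open>1/Q\<close> turns \<open>B\<close> into \<open>B\<^sup>*\<close>, so that one development covers both maps.\<close>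

locale split_system = vector_space_over scale
  for scale :: "'a::field \<Rightarrow> 'b::ab_group_add \<Rightarrow> 'b" (infixr "*s" 75) +
  fixes A As B :: "'b \<Rightarrow> 'b" and \<theta> \<theta>s \<beta> :: "nat \<Rightarrow> 'a" and d :: nat and Q c cs :: 'a
  assumes grA: "graded A \<theta> d" and grAs: "graded As \<theta>s d"
    and eigenvalue_A: "\<And>i. i \<le> d \<Longrightarrow> is_eigenvalue scale A (\<theta> i)"
    and eigenvalue_As: "\<And>i. i \<le> d \<Longrightarrow> is_eigenvalue scale As (\<theta>s i)"
    and As_flag: "\<And>v i. v \<in> flag A \<theta> d i \<Longrightarrow> As v \<in> flag A \<theta> d (i + 1)"
    and A_flag: "\<And>v i. v \<in> flag As \<theta>s d i \<Longrightarrow> A v \<in> flag As \<theta>s d (i + 1)"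
    and irreducible: "\<And>S. subspace S \<Longrightarrow> A ` S \<subseteq> S \<Longrightarrow> As ` S \<subseteq> S \<Longrightarrow> S = {0} \<or> S = UNIV"
    and linB: "lin B"
    and B_eigen: "\<And>i v. i \<le> d \<Longrightarrow> v \<in> flag As \<theta>s d (int i) \<Longrightarrow> v \<in> flag A \<theta> d (int d - int i) \<Longrightarrow>
      B v = \<beta> i *s v"
    and inj_\<beta>: "inj_on \<beta> {..d}" and \<beta>_nonzero: "\<And>i. i \<le> d \<Longrightarrow> \<beta> i \<noteq> 0"
    and \<beta>_Suc: "\<And>i. i < d \<Longrightarrow> \<beta> (Suc i) = Q * \<beta> i"
    and Q_nonzero: "Q \<noteq> 0"
    and \<theta>_\<beta>: "\<And>i. i \<le> d \<Longrightarrow> \<theta> (d - i) * \<beta> i = c"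
    and \<theta>s_\<beta>: "\<And>i. i \<le> d \<Longrightarrow> \<theta>s i * \<beta> i = cs"
begin

text \<open>The subspaces on which \<open>B\<close> is prescribed; for the reversed orderings they
  are those prescribing \<open>Bstar\<close>.\<close>

definition split_space :: "nat \<Rightarrow> 'b set" where
  "split_space i = flag As \<theta>s d (int i) \<inter> flag A \<theta> d (int d - int i)"

lemma ladder_trivial_UNIV: "ladder A \<theta> As \<theta>s d UNIV n = {0} \<or> ladder A \<theta> As \<theta>s d UNIV n = UNIV"
  using irreducible by (intro ladder_trivial grA grAs As_flag A_flag) auto

lemma eigenvector_exists:
  assumes "lin X" "is_eigenvalue scale X \<mu>"
  obtains v where "v \<in> eig X \<mu>" "v \<noteq> 0"
  using assms subspace_0[OF subspace_eig[OF assms(1), of \<mu>]] by (auto simp: is_eigenvalue_def)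

text \<open>A nonzero vector of the first eigenspace of \<open>A\<close> lies in the ladder with
  \<open>n = d\<close>, which is then everything by irreducibility. Its rungs are split components,
  or zero for indices out of range.\<close>

lemma span_split_space: "span (\<Union>i\<in>{..d}. split_space i) = UNIV"
proof -
  obtain v where v: "v \<in> eig A (\<theta> 0)" "v \<noteq> 0"
    using eigenvector_exists[OF graded_lin[OF grA]] eigenvalue_A by blast
  then have "v \<in> flag A \<theta> d 0" by (intro flag_eigen[OF grA]) auto
  then have L: "ladder A \<theta> As \<theta>s d UNIV (int d) = UNIV"
    using v by (intro ladder_eq[OF ladder_trivial_UNIV, where i = 0 and j = "int d"]) (auto simp: flag_top[OF grAs])
  have "flag A \<theta> d i \<inter> flag As \<theta>s d (int d - i) \<subseteq> insert 0 (\<Union>i\<in>{..d}. split_space i)" for i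
  proof (cases "0 \<le> i \<and> i \<le> int d")
    case True
    then have "flag A \<theta> d i \<inter> flag As \<theta>s d (int d - i) = split_space (d - nat i)"
      by (simp add: split_space_def of_nat_diff nat_le_iff Int_commute)
    then show ?thesis by auto
  qed (use flag_bot[of i] flag_bot[of "int d - i"] in auto)
  then have "(\<Union>i. UNIV \<inter> flag A \<theta> d i \<inter> flag As \<theta>s d (int d - i)) \<subseteq> insert 0 (\<Union>i\<in>{..d}. split_space i)"
    by (auto simp del: insert_iff)
  from span_mono[OF this] show ?thesis using L by (simp add: ladder_def top.extremum_unique)
qed

text \<open>With total index below \<open>d\<close> the whole ladder lies in the proper subspace
  \<open>flag As \<theta>s d (int d - 1)\<close>: rungs with \<open>k < 0\<close> are zero, the
  others have second index at most \<open>d - 1\<close>. So irreducibility makes the ladder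
  zero.\<close>

lemma flag_disjoint:
  assumes "i + j < int d"
  shows "flag A \<theta> d i \<inter> flag As \<theta>s d j = {0}"
proof -
  let ?L = "ladder A \<theta> As \<theta>s d UNIV (i + j)"
  have "flag A \<theta> d k \<inter> flag As \<theta>s d (i + j - k) \<subseteq> flag As \<theta>s d (int d - 1)" for k
  proof (cases "k < 0")
    case True
    then show ?thesis using subspace_0[OF subspace_flag] by (simp add: flag_bot)
  next
    case False
    then show ?thesis using assms flag_mono[of "i + j - k" "int d - 1"] by auto
  qed
  then have "?L \<subseteq> flag As \<theta>s d (int d - 1)"
    unfolding ladder_def by (intro span_minimal subspace_flag) auto
  moreover have "flag As \<theta>s d (int d - 1) \<noteq> UNIV"
  proof -
    obtain v where v: "v \<in> eig As (\<theta>s d)" "v \<noteq> 0"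
      using eigenvector_exists[OF graded_lin[OF grAs]] eigenvalue_As by blast
    then have "eigproj As \<theta>s d d v = v" using eigproj_eigen[OF grAs, of d d v] by (simp add: eigenspace_def)
    then have "v \<notin> flag As \<theta>s d (int d - 1)" using v by (auto simp: mem_flag[OF grAs])
    then show ?thesis by blast
  qed
  ultimately have "?L = {0}" using ladder_trivial_UNIV[of "i + j"] by auto
  moreover have "flag A \<theta> d i \<inter> flag As \<theta>s d j \<subseteq> ?L"
    unfolding ladder_def by (intro order_trans[OF _ span_superset]) (auto intro!: exI[of _ i])
  ultimately show ?thesis using subspace_0[OF subspace_flag] by blast
qed

lemma subspace_split_space: "subspace (split_space i)"
  unfolding split_space_def by (intro subspace_inter subspace_flag)

lemma split_space_eigen: "i \<le> d \<Longrightarrow> split_space i \<subseteq> eig B (\<beta> i)"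
  using B_eigen by (auto simp: split_space_def eigenspace_def)

lemma grB: "graded B \<beta> d"
proof -
  have "span (\<Union>i\<in>{..d}. split_space i) \<subseteq> span (\<Union>i\<in>{..d}. eig B (\<beta> i))"
    using split_space_eigen by (intro span_mono) fast
  then show ?thesis using span_split_space linB inj_\<beta> by (auto simp: graded_def)
qed

lemma eig_B: "i \<le> d \<Longrightarrow> eig B (\<beta> i) = split_space i"
  using eig_eq_of_span[OF grB, of split_space] subspace_split_space split_space_eigen span_split_space by blast

lemma flag_B: "flag B \<beta> d i = flag As \<theta>s d i"
proof (rule flag_eqI[OF grB subspace_flag flag_mono])
  fix k assume k: "k \<le> d"
  show "eig B (\<beta> k) \<subseteq> flag As \<theta>s d (int k)" using k by (auto simp: eig_B split_space_def)
  show "flag As \<theta>s d (int k - 1) \<inter> eig B (\<beta> k) = {0}"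
    using k flag_disjoint[of "int d - int k" "int k - 1"] subspace_0[OF subspace_flag]
    by (auto simp: eig_B split_space_def)
qed

lemma flag_B_rev: "flag B (\<lambda>j. \<beta> (d - j)) d i = flag A \<theta> d i"
proof (rule flag_eqI[OF graded_rev[OF grB] subspace_flag flag_mono])
  fix k assume k: "k \<le> d"
  show "eig B (\<beta> (d - k)) \<subseteq> flag A \<theta> d (int k)" using k by (auto simp: eig_B split_space_def of_nat_diff)
  show "flag A \<theta> d (int k - 1) \<inter> eig B (\<beta> (d - k)) = {0}"
    using k flag_disjoint[of "int k - 1" "int d - int k"] subspace_0[OF subspace_flag]
    by (auto simp: eig_B split_space_def of_nat_diff)
qed

text \<open>The flag of \<open>As\<close> grows strictly at \<open>k\<close>, since
  \<open>\<theta>s k\<close> is an eigenvalue. It is also the flag of \<open>B\<close>, so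
  \<open>B\<close> has a nonzero eigenspace there.\<close>

lemma eigenvalue_B:
  assumes "k \<le> d"
  shows "is_eigenvalue scale B (\<beta> k)"
proof -
  obtain v where v: "v \<in> eig As (\<theta>s k)" "v \<noteq> 0"
    using eigenvector_exists[OF graded_lin[OF grAs]] eigenvalue_As assms by blast
  have "v \<in> flag As \<theta>s d (int k)" by (rule flag_eigen[OF grAs assms v(1)]) simp
  then have vB: "v \<in> flag B \<beta> d (int k)" by (simp add: flag_B)
  have "v \<notin> flag As \<theta>s d (int k - 1)"
    using v assms eigproj_eigen[OF grAs, of k k v] by (auto simp: mem_flag[OF grAs] eigenspace_def)
  then have "v \<notin> flag B \<beta> d (int k - 1)" by (simp add: flag_B)
  then have "eigproj B \<beta> d k v \<noteq> 0"
    using vB unfolding mem_flag[OF grB] by (metis linorder_less_linear of_nat_less_iff zle_diff1_eq not_le)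
  then show ?thesis
    using eigproj_in[OF grB assms] by (auto simp: is_eigenvalue_def eigenspace_def)
qed

text \<open>On split component \<open>k\<close> the map \<open>A\<close> minus
  \<open>\<theta> (d - k)\<close> leads into component \<open>k + 1\<close>, where \<open>B\<close>
  acts as \<open>Q * \<beta> k\<close>. The terms in \<open>w\<close> cancel, and the remaining
  scalar is independent of \<open>k\<close> by \<open>\<theta>_\<beta>\<close>.\<close>

lemma relation_A: "Q *s A (B v) - B (A v) = ((Q - 1) * c) *s v"
proof (rule lin_eq_graded[OF grB, where Y = "\<lambda>v. Q *s A (B v) - B (A v)" and Z = "\<lambda>v. ((Q - 1) * c) *s v"])
  note A = lin_simps[OF graded_lin[OF grA]] and B = lin_simps[OF linB]
  show "lin (\<lambda>v. Q *s A (B v) - B (A v))"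
    by (simp add: lin_iff A B scale_right_distrib scale_right_diff_distrib mult.commute)
  show "lin ((*s) ((Q - 1) * c))" by (simp add: lin_iff scale_right_distrib mult.commute)
  fix k v assume k: "k \<le> d" and Bv: "B v = \<beta> k *s v"
  then have v: "v \<in> flag As \<theta>s d (int k)" "v \<in> flag A \<theta> d (int d - int k)"
    using eig_B[OF k] by (auto simp: eigenspace_def split_space_def)
  define w where "w = A v - \<theta> (d - k) *s v"
  have w1: "w \<in> flag A \<theta> d (int d - int k - 1)"
    using flag_step[OF grA, of "d - k" v] v k by (simp add: w_def of_nat_diff)
  have "v \<in> flag As \<theta>s d (int k + 1)" using v flag_mono[of "int k" "int k + 1"] by auto
  then have w2: "w \<in> flag As \<theta>s d (int k + 1)"
    unfolding w_def using A_flag[OF v(1)] by (intro subspace_diff subspace_scale subspace_flag)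
  have Bw: "B w = (Q * \<beta> k) *s w"
  proof (cases "k < d")
    case True
    then have "B w = \<beta> (Suc k) *s w" using w1 w2 by (intro B_eigen) (auto simp: algebra_simps)
    then show ?thesis using \<beta>_Suc[OF True] by simp
  next
    case False
    then have "w = 0" using w1 k by (simp add: flag_bot)
    then show ?thesis by (simp add: B)
  qed
  have Av: "A v = \<theta> (d - k) *s v + w" by (simp add: w_def)
  have "Q *s A (B v) - B (A v) = ((Q - 1) * (\<theta> (d - k) * \<beta> k)) *s v"
    by (simp add: Bv A B Av Bw scale_right_distrib scale_left_diff_distrib algebra_simps)
  then show "Q *s A (B v) - B (A v) = ((Q - 1) * c) *s v" using \<theta>_\<beta>[OF k] by simp
qed

text \<open>Here \<open>As\<close> minus \<open>\<theta>s k\<close> leads down to component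
  \<open>k - 1\<close>, which is why \<open>B\<close> and the other map trade places compared with
  \<open>relation_A\<close>.\<close>

lemma relation_As: "Q *s B (As v) - As (B v) = ((Q - 1) * cs) *s v"
proof (rule lin_eq_graded[OF grB, where Y = "\<lambda>v. Q *s B (As v) - As (B v)" and Z = "\<lambda>v. ((Q - 1) * cs) *s v"])
  note As = lin_simps[OF graded_lin[OF grAs]] and B = lin_simps[OF linB]
  show "lin (\<lambda>v. Q *s B (As v) - As (B v))"
    by (simp add: lin_iff As B scale_right_distrib scale_right_diff_distrib mult.commute)
  show "lin ((*s) ((Q - 1) * cs))" by (simp add: lin_iff scale_right_distrib mult.commute)
  fix k v assume k: "k \<le> d" and Bv: "B v = \<beta> k *s v"
  then have v: "v \<in> flag As \<theta>s d (int k)" "v \<in> flag A \<theta> d (int d - int k)"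
    using eig_B[OF k] by (auto simp: eigenspace_def split_space_def)
  define w where "w = As v - \<theta>s k *s v"
  have w1: "w \<in> flag As \<theta>s d (int k - 1)"
    using flag_step[OF grAs, of k v] v k by (simp add: w_def)
  have "v \<in> flag A \<theta> d (int d - int k + 1)" using v flag_mono[of "int d - int k" "int d - int k + 1"] by auto
  then have w2: "w \<in> flag A \<theta> d (int d - int k + 1)"
    unfolding w_def using As_flag[OF v(2)] by (intro subspace_diff subspace_scale subspace_flag)
  have Bw: "Q *s B w = \<beta> k *s w"
  proof (cases k)
    case (Suc l)
    then have "B w = \<beta> l *s w" using w1 w2 k by (intro B_eigen) (auto simp: algebra_simps)
    then show ?thesis using \<beta>_Suc[of l] Suc k by simp
  next
    case 0
    then have "w = 0" using w1 k by (simp add: flag_bot)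
    then show ?thesis by (simp add: B)
  qed
  have Av: "As v = \<theta>s k *s v + w" by (simp add: w_def)
  have "Q *s B (As v) - As (B v) = ((Q - 1) * (\<theta>s k * \<beta> k)) *s v"
    by (simp add: Bv As B Av Bw scale_right_distrib scale_left_diff_distrib algebra_simps)
  then show "Q *s B (As v) - As (B v) = ((Q - 1) * cs) *s v" using \<theta>s_\<beta>[OF k] by simp
qed

text \<open>The eigenvalues of \<open>A\<close> are geometric with ratio \<open>Q\<close>, because
  \<theta> (d - k) * \<beta> k is constant. So on an eigenvector for
  \<open>\<theta> (d - k)\<close>, \<open>relation_A\<close> says that \<open>A\<close> minus the
  next eigenvalue takes \<open>B v\<close> to a multiple of \<open>v\<close>.\<close>

lemma B_flag_A_rev:
  assumes "v \<in> flag A (\<lambda>j. \<theta> (d - j)) d i"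
  shows "B v \<in> flag A (\<lambda>j. \<theta> (d - j)) d (i + 1)"
proof (rule flag_mapsto_relation[OF graded_rev[OF grA] linB _ assms])
  fix k v assume k: "k < d" and v: "v \<in> eig A (\<theta> (d - k))"
  have "\<theta> (d - k) * \<beta> k = Q * \<theta> (d - Suc k) * \<beta> k"
    using \<theta>_\<beta>[of k] \<theta>_\<beta>[of "Suc k"] \<beta>_Suc[OF k] k by (simp add: algebra_simps)
  then have \<theta>: "\<theta> (d - k) = Q * \<theta> (d - Suc k)" using \<beta>_nonzero[of k] k by simp
  have "Q *s (A (B v) - \<theta> (d - Suc k) *s B v) = ((Q - 1) * c) *s v"
    using relation_A[of v] v \<theta> by (simp add: eigenspace_def lin_simps[OF linB] scale_right_diff_distrib)
  then have "inverse Q *s Q *s (A (B v) - \<theta> (d - Suc k) *s B v) = inverse Q *s ((Q - 1) * c) *s v"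
    by simp
  then have "A (B v) - \<theta> (d - Suc k) *s B v = inverse Q *s ((Q - 1) * c) *s v"
    using Q_nonzero by simp
  then show "A (B v) - \<theta> (d - Suc k) *s B v \<in> eig A (\<theta> (d - k))"
    using subspace_scale[OF subspace_eig[OF graded_lin[OF grA]]] v by metis
qed

lemma B_flag_As_rev:
  assumes "v \<in> flag As (\<lambda>j. \<theta>s (d - j)) d i"
  shows "B v \<in> flag As (\<lambda>j. \<theta>s (d - j)) d (i + 1)"
proof (rule flag_mapsto_relation[OF graded_rev[OF grAs] linB _ assms])
  fix k v assume k: "k < d" and v: "v \<in> eig As (\<theta>s (d - k))"
  define l where "l = d - Suc k"
  have l: "d - k = Suc l" "l < d" using k by (auto simp: l_def)
  have "\<theta>s l * \<beta> l = Q * \<theta>s (Suc l) * \<beta> l"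
    using \<theta>s_\<beta>[of l] \<theta>s_\<beta>[of "Suc l"] \<beta>_Suc[OF l(2)] l by (simp add: algebra_simps)
  then have \<theta>: "\<theta>s l = Q * \<theta>s (Suc l)" using \<beta>_nonzero[of l] l by simp
  have "As (B v) - \<theta>s l *s B v = (- ((Q - 1) * cs)) *s v"
    using relation_As[of v] v \<theta> l(1)
    by (simp add: eigenspace_def lin_simps[OF linB] algebra_simps)
  then show "As (B v) - \<theta>s (d - Suc k) *s B v \<in> eig As (\<theta>s (d - k))"
    using subspace_scale[OF subspace_eig[OF graded_lin[OF grAs]]] v unfolding l_def by metis
qed

end

section \<open>Irreducibility of the new pair\<close>

context vector_space_over
begin

text \<open>Finite dimension enters here: a nonzero subspace of least dimension satisfying
  \<open>P\<close> is minimal.\<close>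

lemma minimal_invariant:
  assumes fin: "finite S0" "span S0 = UNIV"
    and S: "subspace S" "S \<noteq> {0}" "P S"
  obtains W where "subspace W" "W \<noteq> {0}" "P W"
    "\<And>T. subspace T \<Longrightarrow> T \<subseteq> W \<Longrightarrow> P T \<Longrightarrow> T = {0} \<or> T = W"
proof -
  obtain Bs where Bs: "Bs \<subseteq> S0" "independent Bs" "S0 \<subseteq> span Bs"
    using maximal_independent_subset by blast
  then have "span Bs = UNIV" using fin span_minimal[OF Bs(3) subspace_span] by auto
  then interpret fd: finite_dimensional_vector_space scale Bs
    using Bs fin by unfold_locales (auto intro: finite_subset)
  obtain W where W: "subspace W \<and> W \<noteq> {0} \<and> P W"
    and least: "\<And>T. subspace T \<and> T \<noteq> {0} \<and> P T \<Longrightarrow> dim W \<le> dim T"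
    using ex_has_least_nat[of "\<lambda>W. subspace W \<and> W \<noteq> {0} \<and> P W" S dim] S by blast
  have "T = {0} \<or> T = W" if "subspace T" "T \<subseteq> W" "P T" for T
    using fd.subspace_dim_equal[of T W] least[of T] that W by blast
  then show ?thesis using that W by blast
qed

lemma irreducible_flags:
  assumes fin: "finite S0" "span S0 = UNIV"
    and A: "graded A \<theta> d" and As: "graded As \<theta>s d" and B: "graded B \<beta> d" and C: "graded C \<gamma> d"
    and flag_B: "\<And>i. flag B \<beta> d i = flag As \<theta>s d i"
    and flag_B_rev: "\<And>i. flag B (\<lambda>j. \<beta> (d - j)) d i = flag A \<theta> d i"
    and flag_C: "\<And>i. flag C \<gamma> d i = flag As (\<lambda>j. \<theta>s (d - j)) d i"
    and flag_C_rev: "\<And>i. flag C (\<lambda>j. \<gamma> (d - j)) d i = flag A (\<lambda>j. \<theta> (d - j)) d i"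
    and B_A: "\<And>v i. v \<in> flag A (\<lambda>j. \<theta> (d - j)) d i \<Longrightarrow> B v \<in> flag A (\<lambda>j. \<theta> (d - j)) d (i + 1)"
    and B_As: "\<And>v i. v \<in> flag As (\<lambda>j. \<theta>s (d - j)) d i \<Longrightarrow> B v \<in> flag As (\<lambda>j. \<theta>s (d - j)) d (i + 1)"
    and C_A: "\<And>v i. v \<in> flag A \<theta> d i \<Longrightarrow> C v \<in> flag A \<theta> d (i + 1)"
    and C_As: "\<And>v i. v \<in> flag As \<theta>s d i \<Longrightarrow> C v \<in> flag As \<theta>s d (i + 1)"
    and irr: "\<And>S. subspace S \<Longrightarrow> A ` S \<subseteq> S \<Longrightarrow> As ` S \<subseteq> S \<Longrightarrow> S = {0} \<or> S = UNIV"
    and S: "subspace S" "B ` S \<subseteq> S" "C ` S \<subseteq> S"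
  shows "S = {0} \<or> S = UNIV"
proof (cases "S = {0}")
  case False
  \<comment> \<open>Keeping \<open>T\<close> inside \<open>S\<close> in the predicate lets
    \<open>W = UNIV\<close> force \<open>S = UNIV\<close> at the end.\<close>
  then obtain W where W: "subspace W" "W \<noteq> {0}" "B ` W \<subseteq> W \<and> C ` W \<subseteq> W \<and> W \<subseteq> S"
    and min: "\<And>T. subspace T \<Longrightarrow> T \<subseteq> W \<Longrightarrow> B ` T \<subseteq> T \<and> C ` T \<subseteq> T \<and> T \<subseteq> S \<Longrightarrow> T = {0} \<or> T = W"
    using minimal_invariant[OF fin S(1), where P = "\<lambda>T. B ` T \<subseteq> T \<and> C ` T \<subseteq> T \<and> T \<subseteq> S"] S
    by (metis (mono_tags, lifting) order_refl)
  have BW: "B ` W \<subseteq> W" and CW: "C ` W \<subseteq> W" and WS: "W \<subseteq> S" using W(3) by auto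
  have min': "T = {0} \<or> T = W" if "subspace T" "T \<subseteq> W" "B ` T \<subseteq> T" "C ` T \<subseteq> T" for T
    using min[of T] that WS by blast
  obtain m v where m: "m \<le> d" "W \<subseteq> flag B \<beta> d (int m)"
    "v \<in> W" "v \<in> flag B (\<lambda>j. \<beta> (d - j)) d (int d - int m)" "v \<noteq> 0"
    using invariant_top_index[OF B W(1) BW W(2)] .
  \<comment> \<open>\<open>r\<close> counts in the reversed ordering: \<open>d - r\<close> is the
    smallest index of an eigenspace of \<open>C\<close> meeting \<open>W\<close>.\<close>
  obtain r u where r: "r \<le> d" "W \<subseteq> flag C (\<lambda>j. \<gamma> (d - j)) d (int r)"
    "u \<in> W" "u \<in> flag C \<gamma> d (int d - int r)" "u \<noteq> 0"
    using invariant_top_index[OF graded_rev[OF C] W(1) CW W(2)] unfolding flag_rev_rev .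
  \<comment> \<open>The witness is \<open>v\<close>: it lies in the flag of \<open>A\<close> at
    \<open>d - m\<close> and, being in \<open>W\<close>, in the opposite flag at \<open>r\<close>.
    For the second ladder \<open>u\<close> plays this role with the flags of
    \<open>As\<close>.\<close>
  have "ladder B (\<lambda>j. \<beta> (d - j)) C (\<lambda>j. \<gamma> (d - j)) d W (int d - int m + int r) = W"
    using m(3,4,5) r(2)
    by (intro ladder_eq[where i = "int d - int m" and j = "int r"] ladder_trivial graded_rev B C W BW CW)
       (auto simp: flag_B_rev flag_C_rev min' intro: C_A B_A)
  then have L1: "span (\<Union>i. W \<inter> flag A \<theta> d i \<inter> flag A (\<lambda>j. \<theta> (d - j)) d (int d - int m + int r - i)) = W"
    by (simp add: ladder_def flag_B_rev flag_C_rev)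
  have "ladder B \<beta> C \<gamma> d W (int m + (int d - int r)) = W"
    using m(2) r(3,4,5)
    by (intro ladder_eq[where i = "int m" and j = "int d - int r"] ladder_trivial B C W BW CW)
       (auto simp: flag_B flag_C min' intro: C_As B_As)
  then have L2: "span (\<Union>i. W \<inter> flag As \<theta>s d i \<inter> flag As (\<lambda>j. \<theta>s (d - j)) d (int m + (int d - int r) - i)) = W"
    by (simp add: ladder_def flag_B flag_C)
  \<comment> \<open>The first ladder forces \<open>m \<le> r\<close>, the second \<open>r \<le> m\<close>.\<close>
  have "m = r" using ladder_rev(1)[OF A W(1,2) L1] ladder_rev(1)[OF As W(1,2) L2] by simp
  then have "A ` W \<subseteq> W" "As ` W \<subseteq> W"
    using ladder_rev(2)[OF A W(1,2) L1] ladder_rev(2)[OF As W(1,2) L2] by simp_all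
  then have "W = UNIV" using irr[OF W(1)] W(2) by blast
  then show ?thesis using WS by blast
qed simp

lemma flag_nat: "k \<le> d \<Longrightarrow> flag X \<theta> d (int k) = ssum scale (\<lambda>j. eig X (\<theta> j)) {..k}"
proof -
  assume "k \<le> d"
  then have *: "{j. j \<le> d \<and> int j \<le> int k} = {..k}" by auto
  show ?thesis unfolding flag_def * ..
qed

lemma flag_rev_nat:
  assumes "graded X \<theta> d" "k \<le> d"
  shows "flag X (\<lambda>j. \<theta> (d - j)) d (int d - int k) = ssum scale (\<lambda>j. eig X (\<theta> j)) {k..d}"
proof -
  have "v \<in> ssum scale (\<lambda>j. eig X (\<theta> j)) {k..d} \<longleftrightarrow> v \<in> flag X (\<lambda>j. \<theta> (d - j)) d (int d - int k)" for v
    by (subst mem_ssum_eig[OF assms(1)]) (use assms(2) in \<open>auto simp: flag_rev[OF assms(1)]\<close>)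
  then show ?thesis by blast
qed

end

section \<open>Application to the tridiagonal pair\<close>

theorem theorem9p1:
  fixes s :: "'k::field \<Rightarrow> 'v::ab_group_add \<Rightarrow> 'v"
    and A Astar B Bstar :: "'v \<Rightarrow> 'v"
    and q a astar b bstar :: 'k
    and d :: nat
  assumes "alg_closed_field TYPE('k)"
    and "vector_space s"
    and "\<exists>S. finite S \<and> module.span s S = UNIV"
    and "\<exists>v::'v. v \<noteq> 0"
    and "q \<noteq> 0" and "\<forall>n::nat. n > 0 \<longrightarrow> q ^ n \<noteq> 1"
    and "tridiagonal_pair s A Astar"
    and "standard_eigenvalue_ordering s A Astar d (\<lambda>i. a * q powi (2 * int i - int d))"
    and "standard_eigenvalue_ordering s Astar A d (\<lambda>i. astar * q powi (int d - 2 * int i))"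
    and "a \<noteq> 0" and "astar \<noteq> 0" and "b \<noteq> 0" and "bstar \<noteq> 0"
    and "Vector_Spaces.linear s s B"
    and "\<forall>i\<le>d. \<forall>v \<in> ssum s (\<lambda>j. eigenspace s Astar (astar * q powi (int d - 2 * int j))) {..i}
                   \<inter> ssum s (\<lambda>j. eigenspace s A (a * q powi (2 * int j - int d))) {..d - i}.
               B v = s (b * q powi (2 * int i - int d)) v"
    and "Vector_Spaces.linear s s Bstar"
    and "\<forall>i\<le>d. \<forall>v \<in> ssum s (\<lambda>j. eigenspace s Astar (astar * q powi (int d - 2 * int j))) {d - i..d}
                   \<inter> ssum s (\<lambda>j. eigenspace s A (a * q powi (2 * int j - int d))) {i..d}.
               Bstar v = s (bstar * q powi (int d - 2 * int i)) v"
  shows "tridiagonal_pair s B Bstar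
    \<and> standard_eigenvalue_ordering s B Bstar d (\<lambda>i. b * q powi (2 * int i - int d))
    \<and> standard_eigenvalue_ordering s Bstar B d (\<lambda>i. bstar * q powi (int d - 2 * int i))"
proof -
  interpret vector_space_over s using assms(2) by (simp add: vector_space_over_def)
  define \<theta> where "\<theta> = (\<lambda>i. a * q powi (2 * int i - int d))"
  define \<theta>s where "\<theta>s = (\<lambda>i. astar * q powi (int d - 2 * int i))"
  define \<beta> where "\<beta> = (\<lambda>i. b * q powi (2 * int i - int d))"
  define \<gamma> where "\<gamma> = (\<lambda>i. bstar * q powi (int d - 2 * int i))"
  note q = assms(5)
  \<comment> \<open>As \<open>q\<close> is not a root of unity, its integer powers are distinct;
    hence so are the scalars of \<open>B\<close> and of \<open>Bstar\<close>.\<close>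
  have q_inj: "q powi x = q powi y \<Longrightarrow> x = y" for x y :: int
  proof (rule ccontr)
    assume eq: "q powi x = q powi y" and "x \<noteq> y"
    have "q powi (x - y) = 1" "q powi (y - x) = 1" using eq q by (simp_all add: power_int_diff)
    then have "q powi \<bar>x - y\<bar> = 1" by (simp add: abs_if)
    then have "q ^ nat \<bar>x - y\<bar> = 1" by (simp add: power_int_def)
    then show False using assms(6) \<open>x \<noteq> y\<close> by auto
  qed
  have step: "x * q powi (k + l) = q powi k * (x * q powi l)" for x k l
    using q by (simp add: power_int_add)
  have \<beta>: "inj_on \<beta> {..d}" "\<And>i. \<beta> i \<noteq> 0" and \<gamma>: "inj_on \<gamma> {..d}" "\<And>i. \<gamma> i \<noteq> 0"
    using q assms(12,13) by (auto simp: \<beta>_def \<gamma>_def inj_on_def dest!: q_inj)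
  have \<beta>_Suc: "\<beta> (Suc i) = q powi 2 * \<beta> i" and \<gamma>_Suc: "\<gamma> (Suc i) = q powi (-2) * \<gamma> i" for i
    unfolding \<beta>_def \<gamma>_def by (subst step[symmetric], simp add: algebra_simps)+
  \<comment> \<open>The exponents in each product are opposite, so the powers of \<open>q\<close>
    cancel.\<close>
  have \<theta>\<beta>: "\<theta> (d - i) * \<beta> i = a * b" "\<theta>s i * \<beta> i = astar * b"
    and \<theta>\<gamma>: "\<theta> i * \<gamma> i = a * bstar" "\<theta>s (d - i) * \<gamma> i = astar * bstar" if "i \<le> d" for i
  proof -
    have *: "(x * q powi k) * (y * q powi l) = x * y" if "k + l = 0" for x y k l
      using q that by (simp add: power_int_add[symmetric] mult.assoc mult.left_commute[of y])
    show "\<theta> (d - i) * \<beta> i = a * b" "\<theta>s i * \<beta> i = astar * b" "\<theta> i * \<gamma> i = a * bstar" "\<theta>s (d - i) * \<gamma> i = astar * bstar"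
      using that unfolding \<theta>_def \<theta>s_def \<beta>_def \<gamma>_def by (intro *; simp add: of_nat_diff)+
  qed
  have stA: "standard_eigenvalue_ordering s A Astar d \<theta>" and stAs: "standard_eigenvalue_ordering s Astar A d \<theta>s"
    using assms(8,9) by (simp_all only: \<theta>_def \<theta>s_def)
  have lin: "lin A" "lin Astar" and irr: "\<And>S. subspace S \<Longrightarrow> A ` S \<subseteq> S \<Longrightarrow> Astar ` S \<subseteq> S \<Longrightarrow> S = {0} \<or> S = UNIV"
    and grA: "graded A \<theta> d" and grAs: "graded Astar \<theta>s d"
    using assms(7) gradedI_standard stA stAs unfolding tridiagonal_pair_def by blast+
  have ev: "is_eigenvalue s A (\<theta> i)" "is_eigenvalue s Astar (\<theta>s i)" if "i \<le> d" for i
    using stA stAs that unfolding standard_eigenvalue_ordering_def by auto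
  interpret P: split_system s A Astar B \<theta> \<theta>s \<beta> d "q powi 2" "a * b" "astar * b"
  proof (unfold_locales; (fact grA grAs irr ev \<beta>(1) \<theta>\<beta>)?)
    show "Astar v \<in> flag A \<theta> d (i + 1)" if "v \<in> flag A \<theta> d i" for v i
      using standard_flag[OF grA lin(2) stA that] .
    show "A v \<in> flag Astar \<theta>s d (i + 1)" if "v \<in> flag Astar \<theta>s d i" for v i
      using standard_flag[OF grAs lin(1) stAs that] .
    show "B v = s (\<beta> i) v" if i: "i \<le> d" "v \<in> flag Astar \<theta>s d (int i)" "v \<in> flag A \<theta> d (int d - int i)" for i v
      using assms(15) that flag_nat[of i d Astar \<theta>s] flag_nat[of "d - i" d A \<theta>]
      by (simp add: of_nat_diff \<theta>_def \<theta>s_def \<beta>_def)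
    show "q powi 2 \<noteq> 0" using q by simp
  qed (simp_all add: \<beta> \<beta>_Suc lin_simps[OF assms(14)])
  interpret M: split_system s A Astar Bstar "\<lambda>j. \<theta> (d - j)" "\<lambda>j. \<theta>s (d - j)" \<gamma> d "q powi (-2)" "a * bstar" "astar * bstar"
  proof (unfold_locales; (fact graded_rev[OF grA] graded_rev[OF grAs] irr \<gamma>(1) \<theta>\<gamma>)?)
    show "is_eigenvalue s A (\<theta> (d - i))" "is_eigenvalue s Astar (\<theta>s (d - i))" for i
      by (simp_all add: ev)
    show "Astar v \<in> flag A (\<lambda>j. \<theta> (d - j)) d (i + 1)" if "v \<in> flag A (\<lambda>j. \<theta> (d - j)) d i" for v i
      using standard_flag[OF graded_rev[OF grA] lin(2) standard_rev[OF stA] that] .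
    show "A v \<in> flag Astar (\<lambda>j. \<theta>s (d - j)) d (i + 1)" if "v \<in> flag Astar (\<lambda>j. \<theta>s (d - j)) d i" for v i
      using standard_flag[OF graded_rev[OF grAs] lin(1) standard_rev[OF stAs] that] .
    show "Bstar v = s (\<gamma> i) v"
      if i: "i \<le> d" "v \<in> flag Astar (\<lambda>j. \<theta>s (d - j)) d (int i)" "v \<in> flag A (\<lambda>j. \<theta> (d - j)) d (int d - int i)" for i v
      using assms(17) that flag_rev_nat[OF grAs, of "d - i"] flag_rev_nat[OF grA, of i]
      by (simp add: of_nat_diff \<theta>_def \<theta>s_def \<gamma>_def)
    show "q powi (-2) \<noteq> 0" using q by simp
    show "\<theta> (d - (d - i)) * \<gamma> i = a * bstar" if "i \<le> d" for i
      using that \<theta>\<gamma> by simp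
  qed (simp_all add: \<gamma> \<gamma>_Suc lin_simps[OF assms(16)])
  \<comment> \<open>\<open>B\<close> moves the reversed flags, which are the flags of
    \<open>Bstar\<close>. Reversing twice gives back the original ones, so \<open>Bstar\<close>
    moves the flags of \<open>B\<close>.\<close>
  note B_flag = P.B_flag_A_rev P.B_flag_As_rev
  note Bstar_flag = M.B_flag_A_rev[unfolded flag_rev_rev] M.B_flag_As_rev[unfolded flag_rev_rev]
  have stB: "standard_eigenvalue_ordering s B Bstar d \<beta>"
    by (rule standardI_flag[OF P.grB P.eigenvalue_B]) (auto simp: P.flag_B P.flag_B_rev intro: Bstar_flag)
  have stBs: "standard_eigenvalue_ordering s Bstar B d \<gamma>"
    by (rule standardI_flag[OF M.grB M.eigenvalue_B]) (auto simp: M.flag_B M.flag_B_rev intro: B_flag)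
  obtain S0 where S0: "finite S0" "span S0 = UNIV" using assms(3) by blast
  have "tridiagonal_pair s B Bstar"
    unfolding tridiagonal_pair_def
    using assms(14,16) graded_diagonalizable[OF P.grB] graded_diagonalizable[OF M.grB] stB stBs
      irreducible_flags[OF S0 grA grAs P.grB M.grB P.flag_B P.flag_B_rev M.flag_B M.flag_B_rev
        B_flag Bstar_flag irr]
    by blast
  then show ?thesis using stB stBs by (simp add: \<beta>_def \<gamma>_def)
qed

end
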